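(* Let $A = {}^{1}A\, e_1 + {}^{2}A\, e_2 \in \mathbb{C}_2^{m\times n}$ be a bicomplex matrix, with ${}^{1}A, {}^{2}A \in \mathbb{C}_1^{m\times n}$ its idempotent component matrices. Then the idempotent row rank, the idempotent column rank and the modified rank of $A$ coincide: $$\rho_{ir}(A) = \rho_{ic}(A) = \rho_{mr}(A) = \rho({}^{1}A) + \rho({}^{2}A).$$
   Context: $\mathbb{C}_1$ denotes the field of complex numbers (with imaginary unit $i_1$). The bicomplex numbers are the commutative ring $\mathbb{C}_2 = \{z_1 + i_2 z_2 : z_1, z_2\in\mathbb{C}_1\}$ with $i_1^2=i_2^2=-1$, $i_1i_2=i_2i_1$. Put $e_1 = (1+i_1i_2)/2$, $e_2 = (1-i_1i_2)/2$; these are idempotents with $e_1e_2=0$, $e_1+e_2=1$. Every $\xi = z_1+i_2z_2\in\mathbb{C}_2$ is uniquely $\xi = {}^{1}\xi\, e_1 + {}^{2}\xi\, e_2$ with ${}^{1}\xi = z_1 - i_1z_2$, ${}^{2}\xi = z_1+i_1z_2$ in $\mathbb{C}_1$. Applied entrywise, every $A\in\mathbb{C}_2^{m\times n}$ is uniquely $A = {}^{1}A\,e_1+{}^{2}A\,e_2$ with ${}^{1}A,{}^{2}A\in\mathbb{C}_1^{m\times n}$, and similarly for vectors. For $\mathbb{C}_1$-subspaces $U,V\subseteq\mathbb{C}_1^k$, $Ue_1+Ve_2 = \{ue_1+ve_2 : u\in U, v\in V\}\subseteq \mathbb{C}_2^k$. The idempotent row rank $\rho_{ir}(A)$ is the dimension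 over $\mathbb{C}_1$ of the idempotent row space $(\text{row space of }{}^{1}A)e_1+(\text{row space of }{}^{2}A)e_2\subseteq\mathbb{C}_2^n$; the idempotent column rank $\rho_{ic}(A)$ is the dimension over $\mathbb{C}_1$ of the idempotent column space $(\text{column space of }{}^{1}A)e_1+(\text{column space of }{}^{2}A)e_2\subseteq\mathbb{C}_2^m$ (row and column spaces of the complex matrices being taken over $\mathbb{C}_1$). The modified rank is by definition $\rho_{mr}(A)=\rho({}^{1}A)+\rho({}^{2}A)$, where $\rho$ of a complex matrix is its usual rank. *)

theory Defs
  imports "HOL-Analysis.Analysis"
begin

section \<open>The ring of bicomplex numbers\<close>

text \<open>\<open>Bicomplex z1 z2\<close> stands for \<open>z1 + i2 z2\<close>. The multiplication is the one determined by
  \<open>i2\<^sup>2 = -1\<close> and commutativity, not the componentwise one.\<close>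

datatype bicomplex = Bicomplex (bc1: complex) (bc2: complex)

lemma bicomplex_eq_iff: "x = y \<longleftrightarrow> bc1 x = bc1 y \<and> bc2 x = bc2 y"
  by (cases x; cases y) simp

instantiation bicomplex :: comm_ring_1
begin

definition "0 = Bicomplex 0 0"
definition "1 = Bicomplex 1 0"
definition "x + y = Bicomplex (bc1 x + bc1 y) (bc2 x + bc2 y)"
definition "- x = Bicomplex (- bc1 x) (- bc2 x)"
definition "x - y = Bicomplex (bc1 x - bc1 y) (bc2 x - bc2 y)"
definition "x * y =
  Bicomplex (bc1 x * bc1 y - bc2 x * bc2 y) (bc1 x * bc2 y + bc2 x * bc1 y)"

instance
  by standard
    (auto simp: zero_bicomplex_def one_bicomplex_def plus_bicomplex_def uminus_bicomplex_def
       minus_bicomplex_def times_bicomplex_def bicomplex_eq_iff algebra_simps)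

end

lemma bicomplex_sel_simps [simp]:
  "bc1 0 = 0" "bc2 0 = 0" "bc1 1 = 1" "bc2 1 = 0"
  "bc1 (x + y) = bc1 x + bc1 y" "bc2 (x + y) = bc2 x + bc2 y"
  "bc1 (- x) = - bc1 x" "bc2 (- x) = - bc2 x"
  "bc1 (x - y) = bc1 x - bc1 y" "bc2 (x - y) = bc2 x - bc2 y"
  "bc1 (x * y) = bc1 x * bc1 y - bc2 x * bc2 y"
  "bc2 (x * y) = bc1 x * bc2 y + bc2 x * bc1 y"
  by (simp_all add: zero_bicomplex_def one_bicomplex_def plus_bicomplex_def uminus_bicomplex_def
       minus_bicomplex_def times_bicomplex_def)

definition bc_of_complex :: "complex \<Rightarrow> bicomplex" where
  "bc_of_complex z = Bicomplex z 0"

lemma bc_of_complex_sel [simp]: "bc1 (bc_of_complex z) = z" "bc2 (bc_of_complex z) = 0"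
  by (simp_all add: bc_of_complex_def)

definition bc_i1 :: bicomplex where "bc_i1 = bc_of_complex \<i>"
definition bc_i2 :: bicomplex where "bc_i2 = Bicomplex 0 1"

lemma bc_i1_sel [simp]: "bc1 bc_i1 = \<i>" "bc2 bc_i1 = 0"
  by (simp_all add: bc_i1_def)

lemma bc_i2_sel [simp]: "bc1 bc_i2 = 0" "bc2 bc_i2 = 1"
  by (simp_all add: bc_i2_def)

lemma bicomplex_units: "bc_i1 * bc_i1 = - 1" "bc_i2 * bc_i2 = - 1"
  by (simp_all add: bicomplex_eq_iff)

lemma Bicomplex_conv: "Bicomplex z1 z2 = bc_of_complex z1 + bc_i2 * bc_of_complex z2"
  by (simp add: bicomplex_eq_iff)


section \<open>Idempotent components\<close>

text \<open>Bicomplex numbers have no division; the factor \<open>1/2\<close> is embedded from the complex numbers.\<close>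

definition bc_e1 :: bicomplex where "bc_e1 = bc_of_complex (1/2) * (1 + bc_i1 * bc_i2)"
definition bc_e2 :: bicomplex where "bc_e2 = bc_of_complex (1/2) * (1 - bc_i1 * bc_i2)"

lemma bc_e_sel [simp]:
  "bc1 bc_e1 = 1/2" "bc2 bc_e1 = \<i>/2" "bc1 bc_e2 = 1/2" "bc2 bc_e2 = - \<i>/2"
  by (simp_all add: bc_e1_def bc_e2_def)

lemma bc_e_idempotent:
  "bc_e1 * bc_e1 = bc_e1" "bc_e2 * bc_e2 = bc_e2" "bc_e1 * bc_e2 = 0" "bc_e1 + bc_e2 = 1"
  by (simp_all add: bicomplex_eq_iff)

definition idem1 :: "bicomplex \<Rightarrow> complex" where "idem1 x = bc1 x - \<i> * bc2 x"
definition idem2 :: "bicomplex \<Rightarrow> complex" where "idem2 x = bc1 x + \<i> * bc2 x"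

lemma idem_decomp_iff:
  "x = bc_of_complex u * bc_e1 + bc_of_complex v * bc_e2 \<longleftrightarrow> u = idem1 x \<and> v = idem2 x"
proof -
  have *: "a = (u + v) / 2 \<and> b = \<i> * (u - v) / 2 \<longleftrightarrow> u = a - \<i> * b \<and> v = a + \<i> * b" for a b
    by (auto simp: field_simps complex_eq_iff)
  show ?thesis
    using *[of "bc1 x" "bc2 x"]
    by (simp add: bicomplex_eq_iff idem1_def idem2_def field_simps)
qed

definition bc_vec_of_complex :: "complex ^ 'n \<Rightarrow> bicomplex ^ 'n" where
  "bc_vec_of_complex u = (\<chi> i. bc_of_complex (u $ i))"

definition idem1_mat :: "bicomplex ^ 'n ^ 'm \<Rightarrow> complex ^ 'n ^ 'm" where
  "idem1_mat A = (\<chi> i j. idem1 (A $ i $ j))"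

definition idem2_mat :: "bicomplex ^ 'n ^ 'm \<Rightarrow> complex ^ 'n ^ 'm" where
  "idem2_mat A = (\<chi> i j. idem2 (A $ i $ j))"

lemma idem_mat_decomp_iff:
  "A = (\<chi> i j. bc_of_complex (A1 $ i $ j) * bc_e1 + bc_of_complex (A2 $ i $ j) * bc_e2)
     \<longleftrightarrow> A1 = idem1_mat A \<and> A2 = idem2_mat A"
  by (auto simp: vec_eq_iff idem_decomp_iff idem1_mat_def idem2_mat_def)


section \<open>Bicomplex vectors as a complex vector space, and ranks\<close>

definition bc_scale :: "complex \<Rightarrow> bicomplex ^ 'n \<Rightarrow> bicomplex ^ 'n" where
  "bc_scale c x = bc_of_complex c *s x"

interpretation bcvec: vector_space "bc_scale :: complex \<Rightarrow> bicomplex ^ 'n \<Rightarrow> bicomplex ^ 'n"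
  by standard (simp_all add: bc_scale_def vec_eq_iff bicomplex_eq_iff algebra_simps)

text \<open>The set \<open>U e1 + V e2\<close>.\<close>

definition idem_space :: "(complex ^ 'n) set \<Rightarrow> (complex ^ 'n) set \<Rightarrow> (bicomplex ^ 'n) set" where
  "idem_space U V =
     {bc_e1 *s bc_vec_of_complex u + bc_e2 *s bc_vec_of_complex v | u v. u \<in> U \<and> v \<in> V}"

text \<open>For complex vectors \<open>vec.span\<close> is the span over the complex numbers, whereas \<open>span\<close> would be
  the span over the reals; likewise \<open>bcvec.dim\<close> is the dimension over the complex numbers.\<close>

definition idem_row_space :: "bicomplex ^ 'n ^ 'm \<Rightarrow> (bicomplex ^ 'n) set" where
  "idem_row_space A =
     idem_space (vec.span (rows (idem1_mat A))) (vec.span (rows (idem2_mat A)))"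

definition idem_column_space :: "bicomplex ^ 'n ^ 'm \<Rightarrow> (bicomplex ^ 'm) set" where
  "idem_column_space A =
     idem_space (vec.span (columns (idem1_mat A))) (vec.span (columns (idem2_mat A)))"

definition idem_row_rank :: "bicomplex ^ 'n ^ 'm \<Rightarrow> nat" where
  "idem_row_rank A = bcvec.dim (idem_row_space A)"

definition idem_column_rank :: "bicomplex ^ 'n ^ 'm \<Rightarrow> nat" where
  "idem_column_rank A = bcvec.dim (idem_column_space A)"

definition modified_rank :: "bicomplex ^ 'n ^ 'm \<Rightarrow> nat" where
  "modified_rank A = rank (idem1_mat A) + rank (idem2_mat A)"

end

theory Submission
  imports Defs
begin

text \<open>Over any field, expanding the columns of a matrix in a basis of the column space factors the
  matrix through a space of dimension the column rank, so the row rank is at most the column rank;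
  transposition gives equality. The maps \<open>u \<mapsto> u e1\<close> and \<open>v \<mapsto> v e2\<close> are injective and complex linear
  with independent ranges, so \<open>U e1 + V e2\<close> has complex dimension \<open>dim U + dim V\<close>.\<close>

lemma dim_rows_le_dim_columns:
  fixes A :: "'a::field ^ 'n ^ 'm"
  shows "vec.dim (rows A) \<le> vec.dim (columns A)"
proof -
  obtain B where B: "B \<subseteq> columns A" "columns A \<subseteq> vec.span B" "card B = vec.dim (columns A)"
    using vec.basis_exists by metis
  have fin: "finite B"
    using B(1) by (rule finite_subset) (simp add: columns_def full_SetCompr_eq)
  have "\<exists>u. column j A = (\<Sum>b\<in>B. u b *s b)" for j
  proof -
    have "column j A \<in> vec.span B"
      using B(2) by (auto simp: columns_def)
    then show ?thesis
      using vec.span_finite[OF fin] by auto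
  qed
  then obtain c where c: "\<And>j. column j A = (\<Sum>b\<in>B. c j b *s b)"
    by metis
  \<comment> \<open>\<open>R b\<close> collects the coefficients of \<open>b\<close> over all
    columns, so \<open>A\<close> is the sum over \<open>b\<close> of the outer products of
    \<open>b\<close> with \<open>R b\<close>, and every row is a combination of the vectors
    \<open>R b\<close>.\<close>
  define R where "R b = (\<chi> j. c j b)" for b
  have row_eq: "row i A = (\<Sum>b\<in>B. b $ i *s R b)" for i
  proof -
    have "A $ i $ j = (\<Sum>b\<in>B. b $ i * c j b)" for j
      using arg_cong[OF c[of j], of "\<lambda>x. x $ i"]
      by (simp add: column_def mult.commute)
    then show ?thesis
      by (simp add: vec_eq_iff row_def R_def)
  qed
  have "row i A \<in> vec.span (R ` B)" for i
    unfolding row_eq by (intro vec.span_sum vec.span_scale vec.span_base imageI)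
  then have "rows A \<subseteq> vec.span (R ` B)"
    by (auto simp: rows_def)
  then have "vec.dim (rows A) \<le> card (R ` B)"
    using fin by (intro vec.dim_le_card) auto
  also have "\<dots> \<le> vec.dim (columns A)"
    using card_image_le[OF fin] B(3) by metis
  finally show ?thesis .
qed

lemma dim_rows_eq_dim_columns:
  fixes A :: "'a::field ^ 'n ^ 'm"
  shows "vec.dim (rows A) = vec.dim (columns A)"
  using dim_rows_le_dim_columns[of A] dim_rows_le_dim_columns[of "transpose A"]
  by simp

text \<open>Multiplication by a fixed \<open>e\<close> commutes with complex scalars. An arbitrary
  \<open>e\<close> covers \<open>bc_e1\<close> and \<open>bc_e2\<close> at once.\<close>

lemma linear_idempotent_embedding:
  "Vector_Spaces.linear (*s) bc_scale (\<lambda>u :: complex ^ 'n. e *s bc_vec_of_complex u)"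
  by unfold_locales
    (simp_all add: bc_vec_of_complex_def bc_scale_def vec_eq_iff bicomplex_eq_iff algebra_simps)

text \<open>Uniqueness of idempotent components, entry by entry. It yields both the injectivity of
  the two embeddings and the trivial intersection of their ranges.\<close>

lemma idempotent_sum_eq_iff:
  "bc_e1 *s bc_vec_of_complex u + bc_e2 *s bc_vec_of_complex v =
     bc_e1 *s bc_vec_of_complex u' + bc_e2 *s bc_vec_of_complex v' \<longleftrightarrow> u = u' \<and> v = v'"
proof -
  have "bc_e1 * bc_of_complex a + bc_e2 * bc_of_complex b =
      bc_e1 * bc_of_complex a' + bc_e2 * bc_of_complex b' \<longleftrightarrow> a = a' \<and> b = b'" for a b a' b'
    using idem_decomp_iff[of _ a b] idem_decomp_iff[of _ a' b'] by (metis mult.commute)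
  then show ?thesis
    by (auto simp: vec_eq_iff bc_vec_of_complex_def)
qed

text \<open>Existence of idempotent components, which makes the images of a complex basis span all
  bicomplex vectors.\<close>

lemma idem_space_UNIV: "idem_space UNIV UNIV = UNIV"
proof -
  have "x = bc_e1 *s bc_vec_of_complex (\<chi> i. idem1 (x $ i)) +
      bc_e2 *s bc_vec_of_complex (\<chi> i. idem2 (x $ i))" for x :: "bicomplex ^ 'a"
    using idem_decomp_iff by (simp add: vec_eq_iff bc_vec_of_complex_def mult.commute)
  then show ?thesis
    unfolding idem_space_def by blast
qed

lemma dim_idem_space:
  fixes U V :: "(complex ^ 'n) set"
  assumes U: "vec.subspace U" and V: "vec.subspace V"
  shows "bcvec.dim (idem_space U V) = vec.dim U + vec.dim V"
proof -
  define f :: "complex ^ 'n \<Rightarrow> bicomplex ^ 'n" where "f = (\<lambda>u. bc_e1 *s bc_vec_of_complex u)"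
  define g :: "complex ^ 'n \<Rightarrow> bicomplex ^ 'n" where "g = (\<lambda>u. bc_e2 *s bc_vec_of_complex u)"
  interpret f: Vector_Spaces.linear "(*s)" bc_scale f
    unfolding f_def by (rule linear_idempotent_embedding)
  interpret g: Vector_Spaces.linear "(*s)" bc_scale g
    unfolding g_def by (rule linear_idempotent_embedding)
  have fg_iff: "f u + g v = f u' + g v' \<longleftrightarrow> u = u' \<and> v = v'" for u v u' v'
    unfolding f_def g_def by (rule idempotent_sum_eq_iff)
  have space_eq: "idem_space X Y = {x + y |x y. x \<in> f ` X \<and> y \<in> g ` Y}" for X Y
    unfolding idem_space_def f_def g_def by blast
  have inj_f: "inj f" and inj_g: "inj g"
    using fg_iff[of _ 0 _ 0] fg_iff[of 0 _ 0] by (auto intro: injI)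

  \<comment> \<open>The dimension formula for sums used below is stated for finite-dimensional
    spaces; the finite spanning set \<open>?S\<close> forces every basis \<open>B\<close> to be
    finite.\<close>
  let ?S = "f ` cart_basis \<union> g ` cart_basis"
  have "f u \<in> bcvec.span ?S" "g u \<in> bcvec.span ?S" for u
  proof -
    have u: "u \<in> vec.span cart_basis"
      by simp
    show "f u \<in> bcvec.span ?S"
      using f.span_image[of cart_basis] u bcvec.span_mono[of "f ` cart_basis" ?S] by blast
    show "g u \<in> bcvec.span ?S"
      using g.span_image[of cart_basis] u bcvec.span_mono[of "g ` cart_basis" ?S] by blast
  qed
  then have span_S: "UNIV \<subseteq> bcvec.span ?S"
    unfolding idem_space_UNIV[symmetric] space_eq by (auto intro: bcvec.span_add)
  obtain B :: "(bicomplex ^ 'n) set" where B: "bcvec.independent B" "UNIV \<subseteq> bcvec.span B"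
    using bcvec.basis_exists by metis
  have "finite B"
    using bcvec.independent_span_bound[of ?S B] B span_S finite_cart_basis by blast
  then interpret fin: finite_dimensional_vector_space "bc_scale :: complex \<Rightarrow> bicomplex ^ 'n \<Rightarrow> _" B
    using B by unfold_locales auto
  interpret pair: finite_dimensional_vector_space_pair_1
    "(*s) :: complex \<Rightarrow> complex ^ 'n \<Rightarrow> _" cart_basis "bc_scale :: complex \<Rightarrow> bicomplex ^ 'n \<Rightarrow> _"
    by unfold_locales

  have "f ` U \<inter> g ` V = {0}"
  proof -
    \<comment> \<open>A common element \<open>f u = g v\<close> reads
      \<open>f u + g 0 = f 0 + g v\<close>, so uniqueness gives \<open>u = 0\<close>.\<close>
    have "x = 0" if "x \<in> f ` U" "x \<in> g ` V" for x
      using that fg_iff[of _ 0 0] by force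
    moreover have "0 \<in> f ` U" "0 \<in> g ` V"
      using U V vec.subspace_0 f.zero g.zero by (metis imageI)+
    ultimately show ?thesis
      by blast
  qed
  \<comment> \<open>Grassmann's formula for the sum of two subspaces.\<close>
  moreover have "bcvec.dim {x + y |x y. x \<in> f ` U \<and> y \<in> g ` V} + bcvec.dim (f ` U \<inter> g ` V) =
      bcvec.dim (f ` U) + bcvec.dim (g ` V)"
    using U V by (intro fin.dim_sums_Int f.subspace_image g.subspace_image)
  moreover have "bcvec.dim (f ` U) = vec.dim U" "bcvec.dim (g ` V) = vec.dim V"
    using inj_f inj_g by (auto intro!: pair.dim_image_eq f.linear_axioms g.linear_axioms
        intro: inj_on_subset)
  ultimately show ?thesis
    by (simp add: space_eq)
qed

theorem corollary2p6:
  fixes A :: "bicomplex ^ 'n ^ 'm"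
  shows "idem_row_rank A = idem_column_rank A \<and>
         idem_column_rank A = modified_rank A \<and>
         modified_rank A = rank (idem1_mat A) + rank (idem2_mat A)"
  \<comment> \<open>Spans keep the dimension of their generators and \<open>rank\<close> is the
    dimension of the rows, so equality of row and column rank settles the column side.\<close>
  by (simp add: idem_row_rank_def idem_column_rank_def modified_rank_def idem_row_space_def
      idem_column_space_def dim_idem_space row_rank_def_gen dim_rows_eq_dim_columns)

end
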